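(* For all integers $n \geq 2$, there exist $n$-vertex simple graphs $X$ and $Y$ such that the friends-and-strangers graph $\mathsf{FS}(X,Y)$ has a connected component with diameter $e^{\Omega(n)}$.
   Context: For simple graphs $X$ and $Y$ on $n$ vertices, the friends-and-strangers graph $\mathsf{FS}(X,Y)$ has as vertices all bijections $V(X)\to V(Y)$; two bijections $\sigma,\tau$ are adjacent if and only if there is an edge $\{a,b\}\in E(X)$ with $\{\sigma(a),\sigma(b)\}\in E(Y)$, $\sigma(a)=\tau(b)$, $\sigma(b)=\tau(a)$, and $\sigma(c)=\tau(c)$ for all $c\in V(X)\setminus\{a,b\}$. The diameter of a connected component is the maximum graph distance between two of its vertices. Asymptotic notation is as $n\to\infty$. *)

theory Defs
  imports "Graph_Theory.Graph_Theory" "HOL-Library.Landau_Symbols"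
begin

text \<open>
  A finite simple graph is a \<^locale>\<open>pair_graph\<close>: a finite vertex set together with a symmetric
  irreflexive set of arcs, an edge \<open>{a, b}\<close> being represented by the two arcs \<open>(a, b)\<close> and
  \<open>(b, a)\<close>.
\<close>

text \<open>
  The vertices are restricted to \<^const>\<open>extensional\<close> functions, so that each bijection between
  the two vertex sets is represented by exactly one HOL function.
\<close>

definition friends_strangers ::
  "'a pair_pre_digraph \<Rightarrow> 'b pair_pre_digraph \<Rightarrow> ('a \<Rightarrow> 'b) pair_pre_digraph" where
  "friends_strangers X Y =
    (let V = {\<sigma> \<in> extensional (pverts X). bij_betw \<sigma> (pverts X) (pverts Y)} in
      \<lparr> pverts = V,
        parcs = {(\<sigma>, \<tau>). \<sigma> \<in> V \<and> \<tau> \<in> V \<and>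
          (\<exists>a b. (a, b) \<in> parcs X \<and> (\<sigma> a, \<sigma> b) \<in> parcs Y \<and>
             \<sigma> a = \<tau> b \<and> \<sigma> b = \<tau> a \<and> (\<forall>c \<in> pverts X - {a, b}. \<sigma> c = \<tau> c))} \<rparr>)"

lemma pair_graph_friends_strangers:
  assumes "pair_graph X" "pair_graph Y"
  shows "pair_graph (friends_strangers X Y)"
proof -
  interpret X: pair_graph X by fact
  interpret Y: pair_graph Y by fact
  let ?F = "friends_strangers X Y"
  have "pverts ?F \<subseteq> pverts X \<rightarrow>\<^sub>E pverts Y"
    by (auto simp: friends_strangers_def PiE_def bij_betw_def)
  then have finV: "finite (pverts ?F)"
    by (rule finite_subset) (intro finite_PiE X.pair_finite_verts Y.pair_finite_verts)
  have sub: "parcs ?F \<subseteq> pverts ?F \<times> pverts ?F"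
    by (auto simp: friends_strangers_def Let_def)
  show ?thesis
  proof
    show "finite (parcs ?F)"
      using finite_subset[OF sub] finV by simp
    show "symmetric (with_proj ?F)"
      unfolding symmetric_def
    proof (rule symI)
      fix \<sigma> \<tau> assume "(\<sigma>, \<tau>) \<in> arcs_ends (with_proj ?F)"
      then obtain a b where V: "\<sigma> \<in> pverts ?F" "\<tau> \<in> pverts ?F"
        and ab: "(a, b) \<in> parcs X" "(\<sigma> a, \<sigma> b) \<in> parcs Y" "\<sigma> a = \<tau> b" "\<sigma> b = \<tau> a"
          "\<forall>c \<in> pverts X - {a, b}. \<sigma> c = \<tau> c"
        by (auto simp: friends_strangers_def Let_def)
      have "(\<tau> a, \<tau> b) \<in> parcs Y"
        using ab Y.pair_sym_arcs by (auto simp: symmetric_def dest: symD)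
      then show "(\<tau>, \<sigma>) \<in> arcs_ends (with_proj ?F)"
        using V ab by (force simp: friends_strangers_def Let_def)
    qed
    show "fst e \<noteq> snd e" if "e \<in> parcs ?F" for e
    proof
      assume eq: "fst e = snd e"
      from that obtain a b where "(a, b) \<in> parcs X" "fst e a = snd e b"
        "bij_betw (fst e) (pverts X) (pverts Y)"
        by (auto simp: friends_strangers_def Let_def)
      then show False
        using eq X.in_arcsD1[of a b] X.in_arcsD2[of a b] X.pair_no_loops[of "(a, b)"]
        by (auto simp: bij_betw_def dest: inj_onD)
    qed
  qed (use sub finV in auto)
qed

text \<open>
  As \<^const>\<open>friends_strangers\<close> yields a symmetric digraph, its connected components are its
  strongly connected components.
\<close>

abbreviation components :: "('a, 'b) pre_digraph \<Rightarrow> ('a, 'b) pre_digraph set" where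
  "components G \<equiv> pre_digraph.sccs G"

definition graph_dist :: "('a, 'b) pre_digraph \<Rightarrow> 'a \<Rightarrow> 'a \<Rightarrow> ereal" where
  "graph_dist G u v = wf_digraph.\<mu> G (\<lambda>_. 1) u v"

text \<open>Intended for finite nonempty graphs only, because of \<^const>\<open>Max\<close>.\<close>

definition graph_diameter :: "('a, 'b) pre_digraph \<Rightarrow> ereal" where
  "graph_diameter G = Max {graph_dist G u v | u v. u \<in> verts G \<and> v \<in> verts G}"

end

(*
Let X describe which people are friends and Y which places are adjacent, so that a bijection X -> Y
tells where everybody is. Layer i has a track of nine places (i,0), ..., (i,8) and nine people: a
token (i,0) and eight blanks (i,1), ..., (i,8). The token is a friend of all its blanks, which
are strangers to each other, so the blanks keep their order along the track. In the track of layer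
i+1, the edges 2-3, 4-5, 6-7 are replaced by gates, which are paths through the places 0, 8, 1,
respectively, of the track of layer i. The token of layer i+1 and the blanks 3, 5, 7 next to the
gates are strangers to the blanks of layer i, but friends of its token k. So the token x can pass a
gate, exchanging places with the blank e beyond it, only while k is in the gate, by the swaps
x k e -> k x e -> k e x -> e k x, during which k leaves its track by a single step. To cross its
track, the token of layer i+1 thus needs the token of layer i at 0, then at 8, then at 1. This doubles
the number of crossings from each layer to the one below: m layers give a diameter of at least
2^(m - 1).
*)

theory Submission
  imports Defs "HOL-Combinatorics.Transposition"
begin

section \<open>A lower bound for diameters\<close>

text \<open>
  The relation \<open>R\<close> plays the role of a 1-Lipschitz potential. It also carries an invariant of the
  walks starting at \<open>u\<close>, namely that some potential value is defined.
\<close>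

lemma ex_component_diameter_ge:
  fixes G :: "'a pair_pre_digraph" and R :: "'a \<Rightarrow> int \<Rightarrow> bool"
  assumes "pair_graph G" and reach: "u \<rightarrow>\<^sup>*\<^bsub>with_proj G\<^esub> v" and start: "R u 0"
    and step: "\<And>x y c. (x, y) \<in> parcs G \<Longrightarrow> R x c \<Longrightarrow> \<exists>c'. R y c' \<and> \<bar>c' - c\<bar> \<le> 1"
    and final: "\<And>c. R v c \<Longrightarrow> K \<le> c"
  shows "\<exists>C d. C \<in> components (with_proj G) \<and> graph_diameter C = ereal d \<and> real_of_int K \<le> d"
proof -
  interpret pair_graph G by fact
  define C where "C = with_proj G \<restriction> {w. u \<rightarrow>\<^sup>*\<^bsub>with_proj G\<^esub> w}"
  have u: "u \<in> pverts G"
    using reach by (rule reachable_in_verts(1))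
  have CC: "C \<in> components (with_proj G)"
    unfolding C_def by (rule induce_reachable_is_in_sccs) (use u in simp)
  then have sc: "strongly_connected C" and ind: "induced_subgraph C (with_proj G)"
    by (auto elim: in_sccsE)
  interpret C: wf_digraph C
    using ind by (rule wf_digraphI_induced)
  have vC: "verts C = {w. u \<rightarrow>\<^sup>*\<^bsub>with_proj G\<^esub> w}"
    by (simp add: C_def)
  have aC: "arcs C \<subseteq> parcs G" "tail C = fst" "head C = snd"
    by (auto simp: C_def)
  have uv: "u \<in> verts C" "v \<in> verts C"
    using u reach by (auto simp: vC)
  have "verts C \<subseteq> pverts G"
    using reachable_in_verts(2) by (auto simp: vC)
  then have fin: "finite (verts C)"
    using pair_finite_verts by (rule finite_subset)
  have cost: "C.awalk_cost (\<lambda>_. 1) p = real (length p)" for p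
    by (induction p) auto
  have walk: "\<exists>c'. R y c' \<and> \<bar>c' - c\<bar> \<le> int (length p)" if "C.awalk x p y" "R x c" for x p y c
    using that
  proof (induction p arbitrary: x c)
    case Nil
    then show ?case by (auto simp: C.awalk_Nil_iff)
  next
    case (Cons e p)
    then have e: "e \<in> arcs C" "fst e = x" "C.awalk (snd e) p y"
      by (auto simp: C.awalk_Cons_iff aC)
    then have "(x, snd e) \<in> parcs G"
      using aC(1) by force
    then obtain c1 where c1: "R (snd e) c1" "\<bar>c1 - c\<bar> \<le> 1"
      using step Cons.prems(2) by blast
    obtain c' where "R y c'" "\<bar>c' - c1\<bar> \<le> int (length p)"
      using Cons.IH[OF e(3) c1(1)] by blast
    then show ?case
      using c1(2) by (intro exI[of _ c']) auto
  qed
  \<comment> \<open>Distances are extended reals. Strong connectedness excludes infinity and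
    nonnegative walk costs exclude minus infinity, so the maximum is a real number.\<close>
  have real_dist: "\<exists>r. graph_dist C x y = ereal r" if "x \<in> verts C" "y \<in> verts C" for x y
  proof -
    have "x \<rightarrow>\<^sup>*\<^bsub>C\<^esub> y"
      using sc that by auto
    then obtain p where "C.awalk x p y"
      by (auto simp: C.reachable_awalk)
    then have "graph_dist C x y \<le> ereal (real (length p))"
      unfolding graph_dist_def using C.min_cost_le_walk_cost cost by metis
    moreover have "0 \<le> graph_dist C x y"
      unfolding graph_dist_def C.\<mu>_def by (rule INF_greatest) (simp add: cost)
    ultimately show ?thesis
      by (cases "graph_dist C x y") auto
  qed
  define S where "S = {graph_dist C x y |x y. x \<in> verts C \<and> y \<in> verts C}"
  have "S = (\<lambda>(x, y). graph_dist C x y) ` (verts C \<times> verts C)"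
    by (auto simp: S_def)
  then have S: "finite S" "graph_dist C u v \<in> S"
    using fin uv by (auto simp: S_def)
  then have "Max S \<in> S"
    by (intro Max_in) auto
  then obtain x y where "Max S = graph_dist C x y" "x \<in> verts C" "y \<in> verts C"
    unfolding S_def by blast
  then obtain d where d: "Max S = ereal d"
    using real_dist by metis
  have "ereal (real_of_int K) \<le> graph_dist C u v"
    unfolding graph_dist_def C.\<mu>_def
  proof (rule INF_greatest)
    fix p assume "p \<in> {p. C.awalk u p v}"
    then obtain c where "R v c" "\<bar>c - 0\<bar> \<le> int (length p)"
      using walk[OF _ start] by blast
    then have "K \<le> int (length p)"
      using final[of c] by auto
    then have "real_of_int K \<le> real (length p)"
      by linarith
    then show "ereal (real_of_int K) \<le> ereal (C.awalk_cost (\<lambda>_. 1) p)"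
      by (simp add: cost)
  qed
  also have "\<dots> \<le> Max S"
    using S by simp
  finally have "real_of_int K \<le> d"
    by (simp add: d)
  moreover have "graph_diameter C = ereal d"
    using d by (simp add: graph_diameter_def S_def)
  ultimately show ?thesis
    using CC by blast
qed

section \<open>Friends-and-strangers graphs\<close>

definition exch :: "('a \<Rightarrow> 'b) \<Rightarrow> 'a \<Rightarrow> 'a \<Rightarrow> 'a \<Rightarrow> 'b" where
  "exch f u v = f(u := f v, v := f u)"

lemma exch_commute: "exch f u v = exch f v u"
  by (auto simp: exch_def)

lemma exch_exch [simp]: "exch (exch f u v) u v = f"
  by (auto simp: exch_def)

lemma exch_eq_comp: "exch f u v = f \<circ> transpose u v"
  by (auto simp: exch_def transpose_def fun_eq_iff)

text \<open>Extensionality determines the neighbour from the swapped pair; it is again a bijection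
  because swapping is precomposition with a transposition.\<close>

lemma friends_strangers_arc_iff:
  assumes "pair_graph X" "pair_graph Y" "\<sigma> \<in> pverts (friends_strangers X Y)"
  shows "(\<sigma>, \<tau>) \<in> parcs (friends_strangers X Y) \<longleftrightarrow>
    (\<exists>a b. (a, b) \<in> parcs X \<and> (\<sigma> a, \<sigma> b) \<in> parcs Y \<and> \<tau> = exch \<sigma> a b)"
proof -
  interpret X: pair_graph X by fact
  have V: "\<sigma> \<in> extensional (pverts X)" "bij_betw \<sigma> (pverts X) (pverts Y)"
    using assms(3) by (auto simp: friends_strangers_def)
  show ?thesis
  proof
    assume "(\<sigma>, \<tau>) \<in> parcs (friends_strangers X Y)"
    then obtain a b where ab: "(a, b) \<in> parcs X" "(\<sigma> a, \<sigma> b) \<in> parcs Y" "\<sigma> a = \<tau> b" "\<sigma> b = \<tau> a"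
      "\<And>c. c \<in> pverts X - {a, b} \<Longrightarrow> \<sigma> c = \<tau> c" and \<tau>: "\<tau> \<in> extensional (pverts X)"
      by (auto simp: friends_strangers_def)
    have "\<tau> c = exch \<sigma> a b c" for c
      using ab(3-5) V(1) \<tau> by (cases "c \<in> pverts X") (auto simp: exch_def extensional_def)
    then show "\<exists>a b. (a, b) \<in> parcs X \<and> (\<sigma> a, \<sigma> b) \<in> parcs Y \<and> \<tau> = exch \<sigma> a b"
      using ab(1,2) by blast
  next
    assume "\<exists>a b. (a, b) \<in> parcs X \<and> (\<sigma> a, \<sigma> b) \<in> parcs Y \<and> \<tau> = exch \<sigma> a b"
    then obtain a b where ab: "(a, b) \<in> parcs X" "(\<sigma> a, \<sigma> b) \<in> parcs Y" "\<tau> = exch \<sigma> a b"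
      by blast
    have in_X: "a \<in> pverts X" "b \<in> pverts X"
      using ab(1) X.wellformed' by blast+
    have "bij_betw (\<sigma> \<circ> transpose a b) (pverts X) (pverts Y)"
      using in_X V(2) by (intro bij_betw_trans[OF _ V(2)]) simp
    then have "bij_betw \<tau> (pverts X) (pverts Y)"
      unfolding ab(3) exch_eq_comp .
    moreover have "\<tau> \<in> extensional (pverts X)"
      using V(1) in_X unfolding ab(3) exch_def extensional_def by auto
    moreover have "\<sigma> a = \<tau> b" "\<sigma> b = \<tau> a" "\<forall>c\<in>pverts X - {a, b}. \<sigma> c = \<tau> c"
      unfolding ab(3) exch_def by auto
    ultimately show "(\<sigma>, \<tau>) \<in> parcs (friends_strangers X Y)"
      using ab(1,2) V unfolding friends_strangers_def Let_def by (simp, intro exI[of _ a] exI[of _ b], simp)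
  qed
qed

section \<open>The layered construction\<close>

text \<open>
  A state is a pair \<open>(t, D)\<close>: the token of layer \<open>i\<close> belongs at place \<open>t i\<close> of its track; if \<open>D i \<noteq> 0\<close>,
  it has moreover changed places with the person who belongs at place \<open>D i\<close> of track \<open>i + 1\<close>. (No
  gate leads to place \<open>0\<close>, so this value is free to stand for ``not displaced''.) On a
  track whose token is at \<open>s\<close>, blank \<open>b\<close> belongs at \<open>slot s b\<close>, and \<open>occupant s\<close> is the inverse
  of \<open>slot s\<close>. Place \<open>q\<close> of a track is adjacent to place \<open>key_slot q\<close> of the track below.
\<close>

definition key_slot :: "nat \<Rightarrow> nat" where
  "key_slot q = (if q < 4 then 0 else if q < 6 then 8 else 1)"

definition gate :: "nat \<Rightarrow> bool" where
  "gate a \<longleftrightarrow> a \<in> {2, 4, 6}"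

definition slot :: "nat \<Rightarrow> nat \<Rightarrow> nat" where
  "slot s b = (if b = 0 then s else if s < b then b else b - 1)"

definition occupant :: "nat \<Rightarrow> nat \<Rightarrow> nat" where
  "occupant s q = (if q = s then 0 else if q < s then Suc q else q)"

definition pos :: "(nat \<Rightarrow> nat) \<Rightarrow> (nat \<Rightarrow> nat) \<Rightarrow> nat \<times> nat \<Rightarrow> nat \<times> nat" where
  "pos t D = (\<lambda>(i, b).
     if b = 0 \<and> D i \<noteq> 0 then (Suc i, D i)
     else if 0 < i \<and> D (i - 1) \<noteq> 0 \<and> D (i - 1) = slot (t i) b then (i - 1, t (i - 1))
     else (i, slot (t i) b))"

text \<open>
  The condition on the parity says that the person at place \<open>D i\<close> is a friend of the displaced
  token, that is, the token of layer \<open>i + 1\<close> or the blank that passes through this gate.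
\<close>

definition valid :: "nat \<Rightarrow> (nat \<Rightarrow> nat) \<Rightarrow> (nat \<Rightarrow> nat) \<Rightarrow> bool" where
  "valid m t D \<longleftrightarrow> (\<forall>i. t i \<le> 8) \<and>
     (\<forall>i. D i \<noteq> 0 \<longrightarrow> Suc i < m \<and> D i \<in> {2..7} \<and> t i = key_slot (D i) \<and>
        (if even (D i) then D i \<le> t (Suc i) else t (Suc i) \<le> D i))"

text \<open>\<open>friend\<close> and \<open>link\<close> list each edge in one orientation only,
  here with a token first; \<open>layered\<close> symmetrises them.\<close>

definition friend :: "nat \<Rightarrow> nat \<times> nat \<Rightarrow> nat \<times> nat \<Rightarrow> bool" where
  "friend m = (\<lambda>(i, a) (j, b). a = 0 \<and> j < m \<and>
     (j = i \<and> b \<in> {1..8} \<or> j = Suc i \<and> b \<in> {0, 3, 5, 7}))"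

definition link :: "nat \<Rightarrow> nat \<times> nat \<Rightarrow> nat \<times> nat \<Rightarrow> bool" where
  "link m = (\<lambda>(i, a) (j, b). j < m \<and>
     (j = i \<and> b = Suc a \<and> a < 8 \<and> (i = 0 \<or> \<not> gate a) \<or>
      j = Suc i \<and> b \<in> {2..7} \<and> a = key_slot b))"

text \<open>\<open>t i\<close> is the lower end of the step. A retreat, being a reversed advance, is
  tested in the state that it leads to.\<close>

definition may_advance :: "nat \<Rightarrow> (nat \<Rightarrow> nat) \<Rightarrow> bool" where
  "may_advance i t \<longleftrightarrow> (\<forall>k. i = Suc k \<longrightarrow> gate (t i) \<longrightarrow> t k = key_slot (t i))"

section \<open>Effect of single moves on the arrangement\<close>

lemma slot_Suc:
  "slot (Suc s) b = (if b = 0 then slot s (Suc s) else if b = Suc s then slot s 0 else slot s b)"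
  by (auto simp: slot_def)

lemma slot_eq_iff: "slot s b = q \<longleftrightarrow> b = occupant s q"
  unfolding slot_def occupant_def by (cases b; cases "q = s"; cases "q < s"; simp; linarith)

text \<open>\<open>slot s\<close> and \<open>slot (Suc s)\<close> differ only at the token and at
  blank \<open>Suc s\<close>. A displacement from below is tied to a place, not to a person, so it
  survives the move; this covers the swap of token and blank inside a gate.\<close>

lemma pos_advance:
  assumes "D i = 0"
  shows "pos (t(i := Suc (t i))) D = exch (pos t D) (i, 0) (i, Suc (t i))"
proof
  fix w :: "nat \<times> nat"
  obtain j b where w: "w = (j, b)" by fastforce
  let ?t = "t(i := Suc (t i))"
  have base: "pos s D (j, b) = (if b = 0 \<and> D j \<noteq> 0 then (Suc j, D j)
     else if 0 < j \<and> D (j - 1) \<noteq> 0 \<and> D (j - 1) = slot (s j) b then (j - 1, s (j - 1))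
     else (j, slot (s j) b))" for s j b
    by (simp add: pos_def)
  show "pos ?t D w = exch (pos t D) (i, 0) (i, Suc (t i)) w"
  proof (cases "j = i")
    case True
    have "pos ?t D (i, b) = pos t D (i, if b = 0 then Suc (t i) else if b = Suc (t i) then 0 else b)"
      using assms by (cases i) (simp_all add: base slot_Suc)
    then show ?thesis
      unfolding w True exch_def by simp
  next
    case False
    then have "pos ?t D (j, b) = pos t D (j, b)"
      using assms by (cases j) (auto simp: base)
    then show ?thesis
      using False unfolding w exch_def by simp
  qed
qed

text \<open>The assumptions ensure that the two people to be exchanged really stand at
  \<open>(i, t i)\<close> and \<open>(Suc i, q)\<close>.\<close>

lemma pos_displace:
  assumes D0: "D i = 0" and q0: "q \<noteq> 0"
    and home: "\<And>k. i = Suc k \<Longrightarrow> D k \<noteq> 0 \<Longrightarrow> D k \<noteq> t i"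
    and next_home: "t (Suc i) = q \<Longrightarrow> D (Suc i) = 0"
  shows "pos t (D(i := q)) = exch (pos t D) (i, 0) (Suc i, occupant (t (Suc i)) q)"
proof
  fix w :: "nat \<times> nat"
  obtain j b where w: "w = (j, b)" by fastforce
  define c where "c = occupant (t (Suc i)) q"
  have c: "slot (t (Suc i)) b = q \<longleftrightarrow> b = c" "slot (t (Suc i)) c = q"
    using slot_eq_iff by (simp_all add: c_def)
  have c0: "c = 0 \<longrightarrow> D (Suc i) = 0"
    using next_home by (auto simp: c_def occupant_def split: if_splits)
  have Q: "pos t D (i, 0) = (i, t i)"
    using D0 home by (cases i) (auto simp: pos_def slot_def)
  have P: "pos t D (Suc i, c) = (Suc i, q)"
    using D0 c0 c(2) unfolding pos_def by auto
  consider "j = i" "b = 0" | "j = i" "b \<noteq> 0" | "j = Suc i" "b = c" | "j = Suc i" "b \<noteq> c"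
    | "j \<noteq> i" "j \<noteq> Suc i" by blast
  then show "pos t (D(i := q)) w = exch (pos t D) (i, 0) (Suc i, occupant (t (Suc i)) q) w"
    unfolding c_def[symmetric] w
  proof cases
    case 1
    have "pos t (D(i := q)) (i, 0) = (Suc i, q)"
      using q0 unfolding pos_def by simp
    then show "pos t (D(i := q)) (j, b) = exch (pos t D) (i, 0) (Suc i, c) (j, b)"
      using 1 P unfolding exch_def by simp
  next
    case 2
    have "pos t (D(i := q)) (i, b) = pos t D (i, b)"
      using 2 unfolding pos_def by (cases i) simp_all
    then show "pos t (D(i := q)) (j, b) = exch (pos t D) (i, 0) (Suc i, c) (j, b)"
      using 2 unfolding exch_def by simp
  next
    case 3
    have "pos t (D(i := q)) (Suc i, c) = (i, t i)"
      using q0 c(2) c0 unfolding pos_def by auto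
    then show "pos t (D(i := q)) (j, b) = exch (pos t D) (i, 0) (Suc i, c) (j, b)"
      using 3 Q unfolding exch_def by simp
  next
    case 4
    have "pos t (D(i := q)) (Suc i, b) = pos t D (Suc i, b)"
      using 4 c(1) D0 unfolding pos_def by auto
    then show "pos t (D(i := q)) (j, b) = exch (pos t D) (i, 0) (Suc i, c) (j, b)"
      using 4 unfolding exch_def by simp
  next
    case 5
    then have "pos t (D(i := q)) (j, b) = pos t D (j, b)"
      by (cases j) (simp_all add: pos_def)
    then show "pos t (D(i := q)) (j, b) = exch (pos t D) (i, 0) (Suc i, c) (j, b)"
      using 5 unfolding exch_def by simp
  qed
qed

lemma slot_neq: "0 < b \<Longrightarrow> slot s b \<noteq> s"
  by (auto simp: slot_def)

section \<open>Preservation of validity\<close>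

lemma validD:
  assumes "valid m t D" "D i \<noteq> 0"
  shows "Suc i < m" "D i \<in> {2..7}" "t i = key_slot (D i)"
    "if even (D i) then D i \<le> t (Suc i) else t (Suc i) \<le> D i"
  using assms by (auto simp: valid_def)

lemma valid_upd:
  assumes "valid m t D" "D i = 0" "s \<le> 8"
    and "\<And>k. i = Suc k \<Longrightarrow> D k \<noteq> 0 \<Longrightarrow> if even (D k) then D k \<le> s else s \<le> D k"
  shows "valid m (t(i := s)) D"
  unfolding valid_def
proof (intro conjI allI impI)
  fix k
  show "(t(i := s)) k \<le> 8"
    using assms(1,3) by (simp add: valid_def)
  assume "D k \<noteq> 0"
  then show "Suc k < m" "D k \<in> {2..7}" "(t(i := s)) k = key_slot (D k)"
    using validD[OF assms(1), of k] assms(2) by auto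
  show "if even (D k) then D k \<le> (t(i := s)) (Suc k) else (t(i := s)) (Suc k) \<le> D k"
    using validD(4)[OF assms(1) \<open>D k \<noteq> 0\<close>] assms(4)[OF _ \<open>D k \<noteq> 0\<close>]
    by (cases "i = Suc k") simp_all
qed

text \<open>One step can break an inequality between \<open>D k\<close> and \<open>t i\<close> only
  if it was an equality, so parity matters just when the token itself has been pushed out of place
  \<open>D k\<close>.\<close>

lemma valid_advance:
  assumes "valid m t D" "D i = 0" "t i < 8" "\<And>k. i = Suc k \<Longrightarrow> D k \<noteq> 0 \<Longrightarrow> D k = t i \<Longrightarrow> even (t i)"
  shows "valid m (t(i := Suc (t i))) D"
proof (rule valid_upd)
  fix k assume "i = Suc k" "D k \<noteq> 0"
  then have "if even (D k) then D k \<le> t i else t i \<le> D k" "D k = t i \<Longrightarrow> even (t i)"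
    using validD(4)[OF assms(1)] assms(4) by auto
  then show "if even (D k) then D k \<le> Suc (t i) else Suc (t i) \<le> D k"
    by (auto simp: Suc_le_eq le_less split: if_splits)
qed (use assms(1-3) in simp_all)

lemma valid_retreat:
  assumes "valid m t D" "D i = 0" "\<And>k. i = Suc k \<Longrightarrow> D k \<noteq> 0 \<Longrightarrow> D k = t i \<Longrightarrow> odd (t i)"
  shows "valid m (t(i := t i - 1)) D"
proof (rule valid_upd)
  fix k assume "i = Suc k" "D k \<noteq> 0"
  then have "if even (D k) then D k \<le> t i else t i \<le> D k" "D k = t i \<Longrightarrow> odd (t i)"
    using validD(4)[OF assms(1)] assms(3) by auto
  then show "if even (D k) then D k \<le> t i - 1 else t i - 1 \<le> D k"
    by (auto simp: le_less split: if_splits)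
next
  show "t i - 1 \<le> 8"
    using assms(1) by (auto simp: valid_def intro: le_trans[OF diff_le_self])
qed (use assms(1,2) in simp_all)

lemma valid_displace:
  assumes "valid m t D" "Suc i < m" "q \<in> {2..7}" "t i = key_slot q"
    "if even q then q \<le> t (Suc i) else t (Suc i) \<le> q"
  shows "valid m t (D(i := q))"
proof -
  have "Suc k < m \<and> (D(i := q)) k \<in> {2..7} \<and> t k = key_slot ((D(i := q)) k) \<and>
      (if even ((D(i := q)) k) then (D(i := q)) k \<le> t (Suc k) else t (Suc k) \<le> (D(i := q)) k)"
    if "(D(i := q)) k \<noteq> 0" for k
    using that validD[OF assms(1), of k] assms(2-5) by (cases "k = i") simp_all
  then show ?thesis
    using assms(1) unfolding valid_def by blast
qed

lemma key_slot_cases: "key_slot q \<in> {0, 1, 8}"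
  by (auto simp: key_slot_def)

text \<open>The three gates have different key places, so equal keys mean the two ends of one gate.
  For this reason the third gate uses place 1 and not 0 again.\<close>

lemma key_slot_eqD:
  assumes "key_slot p = key_slot q" "p \<in> {2..7}" "q \<in> {2..7}" "p \<noteq> q"
  shows "q = Suc p \<and> even p \<and> gate p \<or> p = Suc q \<and> even q \<and> gate q"
proof -
  have "p \<in> {2,3,4,5,6,7}" "q \<in> {2,3,4,5,6,7}"
    using assms by auto
  then show ?thesis
    using assms(1,4) by (auto simp: key_slot_def gate_def)
qed

lemma pos_blank:
  "0 < b \<Longrightarrow> pos t D (i, b) =
     (if 0 < i \<and> D (i - 1) \<noteq> 0 \<and> D (i - 1) = slot (t i) b then (i - 1, t (i - 1)) else (i, slot (t i) b))"
  by (simp add: pos_def)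

lemma pos_token:
  "D i = 0 \<Longrightarrow> pos t D (i, 0) =
     (if 0 < i \<and> D (i - 1) \<noteq> 0 \<and> D (i - 1) = t i then (i - 1, t (i - 1)) else (i, t i))"
  by (simp add: pos_def slot_def)

lemma pos_displaced:
  "D i \<noteq> 0 \<Longrightarrow> pos t D (i, 0) = (Suc i, D i)"
  by (simp add: pos_def)

lemma link_simps:
  "link m (i, a) (i, b) \<longleftrightarrow> i < m \<and> b = Suc a \<and> a < 8 \<and> (i = 0 \<or> \<not> gate a)"
  "link m (i, a) (Suc i, b) \<longleftrightarrow> Suc i < m \<and> b \<in> {2..7} \<and> a = key_slot b"
  "\<not> link m (Suc i, a) (i, b)"
  "j \<noteq> i \<Longrightarrow> j \<noteq> Suc i \<Longrightarrow> \<not> link m (i, a) (j, b)"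
  by (auto simp: link_def)

lemma odd_if_not_gate: "\<not> gate a \<Longrightarrow> a \<in> {1..7} \<Longrightarrow> odd a"
proof -
  assume "\<not> gate a" "a \<in> {1..7}"
  moreover from this have "a \<in> {1,2,3,4,5,6,7}" by auto
  ultimately show "odd a" by (auto simp: gate_def)
qed

section \<open>The possible swaps\<close>

text \<open>\<open>t(i := b - 1)\<close> is the lower end of the move, whether the token advances or
  retreats. The last conjunct supplies the parity assumption of \<open>valid_advance\<close> or
  \<open>valid_retreat\<close>.\<close>

lemma step_same_layer:
  assumes v: "valid m t D" and b: "b \<in> {1..8}"
    and l: "link m (pos t D (i, 0)) (pos t D (i, b)) \<or> link m (pos t D (i, b)) (pos t D (i, 0))"
  shows "D i = 0 \<and> (b = t i \<or> b = Suc (t i)) \<and> may_advance i (t(i := b - 1)) \<and>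
    (\<forall>k. i = Suc k \<longrightarrow> D k \<noteq> 0 \<longrightarrow> D k = t i \<longrightarrow> (if b = t i then odd (t i) else even (t i)))"
proof -
  have b0: "0 < b" using b by simp
  have nb: "slot (t i) b = Suc (t i) \<longleftrightarrow> b = Suc (t i)" "Suc (slot (t i) b) = t i \<longleftrightarrow> b = t i"
    using b0 by (auto simp: slot_def)
  show ?thesis
  proof (cases "D i = 0")
    \<comment> \<open>A displaced token is adjacent to its own track only at the place
      \<open>t i\<close> that it left, and no blank of its layer belongs there.\<close>
    case False
    have "t i = key_slot (D i)"
      by (rule validD(3)[OF v False])
    moreover have "link m (Suc i, D i) (pos t D (i, b)) \<or> link m (pos t D (i, b)) (Suc i, D i)"
      using l by (simp add: pos_displaced[of D i, OF False])
    ultimately show ?thesis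
      using slot_neq[OF b0, of "t i"]
      by (cases i) (auto simp: pos_blank[OF b0] link_simps split: if_splits)
  next
    case D0: True
    show ?thesis
    proof (cases "0 < i \<and> D (i - 1) \<noteq> 0 \<and> (D (i - 1) = t i \<or> D (i - 1) = slot (t i) b)")
      case False
      then have "link m (i, t i) (i, slot (t i) b) \<or> link m (i, slot (t i) b) (i, t i)"
        using l by (auto simp: pos_token[of D i, OF D0] pos_blank[OF b0])
      then show ?thesis
      proof
        assume "link m (i, t i) (i, slot (t i) b)"
        then show ?thesis
          using D0 False nb by (auto simp: link_simps may_advance_def dest: sym)
      next
        assume "link m (i, slot (t i) b) (i, t i)"
        then have "t i = Suc (slot (t i) b)" "i = 0 \<or> \<not> gate (slot (t i) b)"
          by (auto simp: link_simps)
        moreover from this have "b = t i" "slot (t i) b = t i - 1"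
          using nb by auto
        ultimately show ?thesis
          using D0 False by (auto simp: may_advance_def)
      qed
    next
      \<comment> \<open>Exactly one of token and blank stands in the key place in layer
        \<open>k\<close>; an edge between them makes \<open>t i\<close> and \<open>p\<close> the two
        ends of one gate.\<close>
      case True
      then obtain k where k: "i = Suc k" by (cases i) auto
      have Dk: "D k \<noteq> 0" "D k \<in> {2..7}" "t k = key_slot (D k)"
        using validD[OF v, of k] True k by auto
      define p where "p = slot (t i) b"
      have Dkp: "D k = t i \<or> D k = p"
        using True unfolding k p_def by simp
      have ne: "p \<noteq> t i"
        using slot_neq[OF b0] by (simp add: p_def)
      have "link m (if D k = t i then (k, key_slot (D k)) else (Suc k, t i)) (if D k = p then (k, key_slot (D k)) else (Suc k, p)) \<or>
          link m (if D k = p then (k, key_slot (D k)) else (Suc k, p)) (if D k = t i then (k, key_slot (D k)) else (Suc k, t i))"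
        using l Dk unfolding pos_token[of D i, OF D0] pos_blank[OF b0] p_def unfolding k by (simp only: diff_Suc_1 simp_thms zero_less_Suc)
      then have rp: "key_slot p = key_slot (t i)" "p \<in> {2..7}" "t i \<in> {2..7}" and tk: "t k = key_slot (t i)"
        using Dkp Dk ne k by (auto simp: link_simps split: if_splits)
      have bp: "p = Suc (t i) \<Longrightarrow> b = Suc (t i)" "t i = Suc p \<Longrightarrow> b = t i"
        using nb unfolding p_def by auto
      consider "t i = Suc p" "even p" | "p = Suc (t i)" "even (t i)"
        using key_slot_eqD[OF rp ne] by blast
      then show ?thesis
      proof cases
        case 1
        have "may_advance i (t(i := b - 1))"
          using rp(1) tk bp(2)[OF 1(1)] 1(1) unfolding may_advance_def k by simp
        moreover have "if b = t i then odd (t i) else even (t i)"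
          using bp(2)[OF 1(1)] 1 by simp
        ultimately show ?thesis
          using D0 bp(2)[OF 1(1)] by blast
      next
        case 2
        have "may_advance i (t(i := b - 1))"
          using tk bp(1)[OF 2(1)] unfolding may_advance_def k by simp
        moreover have "if b = t i then odd (t i) else even (t i)"
          using bp(1)[OF 2(1)] 2 by simp
        ultimately show ?thesis
          using D0 bp(1)[OF 2(1)] by blast
      qed
    qed
  qed
qed

text \<open>Such a swap can only displace the token of layer \<open>i\<close> or undo its
  displacement. Blank \<open>b\<close> belongs at the odd place \<open>b\<close> or at the even
  place \<open>b - 1\<close>, according to the side of the token, whence the parity
  condition.\<close>

lemma step_next_layer:
  assumes v: "valid m t D" and b: "b \<in> {0, 3, 5, 7}"
    and l: "link m (pos t D (i, 0)) (pos t D (Suc i, b)) \<or> link m (pos t D (Suc i, b)) (pos t D (i, 0))"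
  shows "\<exists>q. Suc i < m \<and> q \<in> {2..7} \<and> t i = key_slot q \<and> b = occupant (t (Suc i)) q \<and> (D i = 0 \<or> D i = q) \<and>
    (if even q then q \<le> t (Suc i) else t (Suc i) \<le> q)"
proof (cases "D i = 0")
  case True
  define q where "q = slot (t (Suc i)) b"
  have P: "pos t D (Suc i, b) = (if b = 0 \<and> D (Suc i) \<noteq> 0 then (Suc (Suc i), D (Suc i)) else (Suc i, q))"
    using True by (auto simp: pos_def q_def)
  have "Suc i < m \<and> t i = key_slot q \<and> q \<in> {2..7}"
    using l unfolding P pos_token[of D i, OF True]
    by (cases i) (auto simp: link_simps split: if_splits)
  moreover have "b = occupant (t (Suc i)) q" "if even q then q \<le> t (Suc i) else t (Suc i) \<le> q"
    using b by (auto simp: q_def slot_def occupant_def)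
  ultimately show ?thesis
    using True by blast
next
  case False
  note Di = validD[OF v False]
  have "b = occupant (t (Suc i)) (D i)"
  proof (rule ccontr)
    assume neq: "b \<noteq> occupant (t (Suc i)) (D i)"
    define q where "q = slot (t (Suc i)) b"
    have "q \<noteq> D i"
      using neq by (auto simp: q_def occupant_def slot_def split: if_splits)
    then have P: "pos t D (Suc i, b) = (if b = 0 \<and> D (Suc i) \<noteq> 0 then (Suc (Suc i), D (Suc i)) else (Suc i, q))"
      by (auto simp: pos_def q_def)
    \<comment> \<open>Key places lie outside 2..7, so person \<open>b\<close> cannot be a token
      displaced into layer \<open>i + 2\<close>.\<close>
    have "D i \<noteq> key_slot (D (Suc i))"
      using Di(2) by (auto simp: key_slot_def)
    then have "link m (Suc i, D i) (Suc i, q) \<or> link m (Suc i, q) (Suc i, D i)"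
      using l unfolding P pos_displaced[of D i, OF False] by (auto simp: link_simps split: if_splits)
    \<comment> \<open>Ungated edges touching 2..7 join an odd place to the next even one. By parity
      the token of layer \<open>i + 1\<close> would be both at or below the odd end and at or above
      the even end.\<close>
    moreover have "if even q then q \<le> t (Suc i) else t (Suc i) \<le> q"
      using b by (auto simp: q_def slot_def)
    ultimately show False
      using Di(2,4) odd_if_not_gate[of q] odd_if_not_gate[of "D i"]
      by (auto simp: link_simps split: if_splits)
  qed
  then show ?thesis
    using Di False by blast
qed

lemma valid_undisplace:
  assumes "valid m t D"
  shows "valid m t (D(i := 0))"
  using assms unfolding valid_def by simp

text \<open>The key places 0, 1, 8 are not ends of gates, so a token that opens a gate above is not
  itself inside a gate below.\<close>

lemma token_home:
  assumes "valid m t D" "D k \<noteq> 0" "t i = key_slot q"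
  shows "D k \<noteq> t i"
proof -
  have "t i \<in> {0, 1, 8}"
    using assms(3) key_slot_cases by metis
  then show ?thesis
    using validD(2)[OF assms(1,2)] by auto
qed

lemma pos_displace_valid:
  assumes "valid m t D" "D i = 0" "q \<in> {2..7}" "t i = key_slot q"
  shows "pos t (D(i := q)) = exch (pos t D) (i, 0) (Suc i, occupant (t (Suc i)) q)"
proof (rule pos_displace)
  show "D k \<noteq> t i" if "i = Suc k" "D k \<noteq> 0" for k
    using token_home[OF assms(1) that(2) assms(4)] .
  show "D (Suc i) = 0" if "t (Suc i) = q"
  proof (rule ccontr)
    assume "D (Suc i) \<noteq> 0"
    then have "t (Suc i) \<in> {0, 1, 8}"
      using validD(3)[OF assms(1)] key_slot_cases by metis
    then show False
      using that assms(3) by auto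
  qed
qed (use assms in auto)

section \<open>A potential on the states\<close>

text \<open>
  While the token of layer \<open>k + 1\<close> is between its first and second gate, the token of layer \<open>k\<close> has to
  cross its own track forwards, and between the second and third gate backwards.
\<close>

fun progress :: "nat \<Rightarrow> (nat \<Rightarrow> nat) \<Rightarrow> int" where
  "progress 0 t = (if t 0 \<le> 2 then 0 else 1)"
| "progress (Suc k) t =
     (if t (Suc k) \<le> 2 then 0 else if t (Suc k) \<le> 4 then progress k t
      else if t (Suc k) \<le> 6 then 2 ^ Suc k - progress k t else 2 ^ Suc k)"

lemma progress_low: "t k \<le> 2 \<Longrightarrow> progress k t = 0"
  by (cases k) auto

lemma progress_high: "7 \<le> t k \<Longrightarrow> progress k t = 2 ^ k"
  by (cases k) auto

text \<open>When the token of layer \<open>k + 1\<close> passes a gate, the potential of layer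
  \<open>k\<close> is 0, \<open>2 ^ k\<close>, 0, respectively, exactly where neighbouring clauses
  of \<open>progress\<close> agree. So the value changes only when the token of layer 0 steps
  between places 2 and 3.\<close>

lemma progress_advance:
  assumes "may_advance i t"
  shows "\<bar>progress k (t(i := Suc (t i))) - progress k t\<bar> \<le> 1"
proof (induction k)
  case 0
  then show ?case by auto
next
  case (Suc k)
  show ?case
  proof (cases "i = Suc k")
    case True
    have upd: "progress k (t(Suc k := x)) = progress k t" for x
    proof -
      have "progress j (t(Suc k := x)) = progress j t" if "j \<le> k" for j
        using that by (induction j) auto
      then show ?thesis by simp
    qed
    consider "t i = 2" "t k = 0" | "t i = 4" "t k = 8" | "t i = 6" "t k = 1"
      | "t i \<notin> {2, 4, 6}"
      using assms True by (auto simp: may_advance_def gate_def key_slot_def split: if_splits)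
    then show ?thesis
      by cases (use True upd in \<open>auto simp: progress_low progress_high simp flip: fun_upd_def\<close>)
  next
    case False
    then have "(t(i := Suc (t i))) (Suc k) = t (Suc k)" by simp
    then show ?thesis
      using Suc.IH by (simp add: abs_minus_commute)
  qed
qed

text \<open>As \<open>exch\<close> is an involution, a retreat is treated as an advance from the new
  state, and the return of a displaced token as a displacement in the new state.\<close>

lemma swap_closed:
  assumes v: "valid m t D" and "friend m u w"
    and l: "link m (pos t D u) (pos t D w) \<or> link m (pos t D w) (pos t D u)"
  shows "\<exists>t' D'. valid m t' D' \<and> pos t' D' = exch (pos t D) u w \<and> \<bar>progress k t' - progress k t\<bar> \<le> 1"
proof -
  obtain i b where u: "u = (i, 0)" and "w = (i, b) \<and> b \<in> {1..8} \<or> w = (Suc i, b) \<and> b \<in> {0, 3, 5, 7}"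
    using assms(2) by (auto simp: friend_def)
  then consider (same) "w = (i, b)" "b \<in> {1..8}" | (below) "w = (Suc i, b)" "b \<in> {0, 3, 5, 7}"
    by blast
  then show ?thesis
  proof cases
    case same
    note s = step_same_layer[OF v same(2) l[unfolded u same(1)]]
    have D0: "D i = 0" using s by blast
    show ?thesis
    proof (cases "b = t i")
      case False
      then have b: "b = Suc (t i)" using s by blast
      have "valid m (t(i := Suc (t i))) D"
        by (rule valid_advance[OF v D0]) (use s False b same(2) in auto)
      moreover have "may_advance i t"
        using s b by simp
      ultimately show ?thesis
        using pos_advance[of D i t, OF D0] progress_advance[of i t k] unfolding u same(1) b by blast
    next
      case True
      define t' where "t' = t(i := t i - 1)"
      have t: "t = t'(i := Suc (t' i))"
        using True same(2) by (auto simp: t'_def)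
      have "valid m t' D"
        unfolding t'_def by (rule valid_retreat[OF v D0]) (use s True in auto)
      moreover have "pos t D = exch (pos t' D) (i, 0) (i, b)"
      proof -
        have "Suc (t' i) = b" using True same(2) by (auto simp: t'_def)
        then show ?thesis using pos_advance[of D i t', OF D0] t by simp
      qed
      then have "pos t' D = exch (pos t D) (i, 0) (i, b)"
        by simp
      moreover have "may_advance i t'"
        using s True unfolding t'_def by simp
      then have "\<bar>progress k t' - progress k t\<bar> \<le> 1"
        using progress_advance[of i t' k] t by simp
      ultimately show ?thesis
        unfolding u same(1) by blast
    qed
  next
    case below
    obtain q where q: "Suc i < m" "q \<in> {2..7}" "t i = key_slot q" "b = occupant (t (Suc i)) q" "D i = 0 \<or> D i = q"
      "if even q then q \<le> t (Suc i) else t (Suc i) \<le> q"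
      using step_next_layer[OF v below(2) l[unfolded u below(1)]] by blast
    define D' where "D' = D(i := if D i = 0 then q else 0)"
    have vD': "valid m t D'"
      using valid_displace[OF v q(1-3,6)] valid_undisplace[OF v] unfolding D'_def by simp
    have "pos t D' = exch (pos t D) (i, 0) (Suc i, b)"
    proof (cases "D i = 0")
      case True
      then show ?thesis
        using pos_displace_valid[OF v True q(2,3)] q(4) unfolding D'_def by simp
    next
      case False
      then have D: "D = D'(i := q)" "D' i = 0"
        using q(5) unfolding D'_def by auto
      have "pos t D = exch (pos t D') (i, 0) (Suc i, b)"
        using pos_displace_valid[OF vD' D(2) q(2,3)] q(4) D(1) by simp
      then show ?thesis by simp
    qed
    then show ?thesis
      using vD' unfolding u below(1) by force
  qed
qed

section \<open>Realisation by graphs on the natural numbers\<close>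

definition enc :: "nat \<times> nat \<Rightarrow> nat" where
  "enc = (\<lambda>(i, a). 9 * i + a)"

definition dec :: "nat \<Rightarrow> nat \<times> nat" where
  "dec p = (p div 9, p mod 9)"

lemma dec_enc [simp]: "snd u < 9 \<Longrightarrow> dec (enc u) = u"
  by (auto simp: dec_def enc_def split: prod.splits)

lemma enc_dec [simp]: "enc (dec p) = p"
  by (simp add: dec_def enc_def)

lemma enc_less: "fst u < m \<Longrightarrow> snd u < 9 \<Longrightarrow> enc u < 9 * m"
  by (auto simp: enc_def split: prod.splits)

definition layered :: "nat \<Rightarrow> (nat \<times> nat \<Rightarrow> nat \<times> nat \<Rightarrow> bool) \<Rightarrow> nat pair_pre_digraph" where
  "layered n R = \<lparr>pverts = {..<n}, parcs = {(enc u, enc v) |u v. R u v \<or> R v u}\<rparr>"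

lemma pverts_layered [simp]: "pverts (layered n R) = {..<n}"
  by (simp add: layered_def)

lemma layered_arc_iff:
  "(p, q) \<in> parcs (layered n R) \<longleftrightarrow> (\<exists>u v. p = enc u \<and> q = enc v \<and> (R u v \<or> R v u))"
  by (simp add: layered_def del: split_paired_Ex)

lemma pair_graph_layered:
  assumes "\<And>u v. R u v \<Longrightarrow> fst u < m \<and> snd u < 9 \<and> fst v < m \<and> snd v < 9 \<and> u \<noteq> v" "9 * m \<le> n"
  shows "pair_graph (layered n R)"
proof -
  have arc: "p < n \<and> q < n \<and> p \<noteq> q" if pq: "(p, q) \<in> parcs (layered n R)" for p q
  proof -
    obtain u v where uv: "p = enc u" "q = enc v" "R u v \<or> R v u"
      using pq unfolding layered_arc_iff by blast
    then have *: "fst u < m \<and> snd u < 9 \<and> fst v < m \<and> snd v < 9 \<and> u \<noteq> v"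
      using assms(1) by metis
    have "enc u \<noteq> enc v"
      using * dec_enc by metis
    then show ?thesis
      using * enc_less[of u m] enc_less[of v m] assms(2) uv by auto
  qed
  have sub: "parcs (layered n R) \<subseteq> {..<n} \<times> {..<n}"
    using arc by auto
  show ?thesis
  proof
    show "finite (parcs (layered n R))"
      using sub by (rule finite_subset) simp
    show "symmetric (with_proj (layered n R))"
      unfolding symmetric_def with_proj_simps by (rule symI) (auto simp: layered_arc_iff)
    show "fst e \<in> pverts (layered n R)" "snd e \<in> pverts (layered n R)" "fst e \<noteq> snd e"
      if "e \<in> parcs (layered n R)" for e
      using arc[of "fst e" "snd e"] that by simp_all
  qed simp
qed

lemma friend_range: "friend m u v \<Longrightarrow> fst u < m \<and> snd u < 9 \<and> fst v < m \<and> snd v < 9 \<and> u \<noteq> v"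
  by (auto simp: friend_def)

lemma link_range: "link m u v \<Longrightarrow> fst u < m \<and> snd u < 9 \<and> fst v < m \<and> snd v < 9 \<and> u \<noteq> v"
  by (auto simp: link_def key_slot_def)

lemma pos_range: "valid m t D \<Longrightarrow> b < 9 \<Longrightarrow> snd (pos t D (i, b)) < 9"
proof -
  assume v: "valid m t D" and b: "b < 9"
  have "t j < 9" for j
  proof -
    have "t j \<le> 8" using v by (simp add: valid_def)
    then show ?thesis by simp
  qed
  moreover from this have "slot (t i) b < 9"
    using b by (auto simp: slot_def)
  moreover have "D i \<noteq> 0 \<Longrightarrow> D i < 9"
    using validD(2)[OF v, of i] by simp
  ultimately show ?thesis
    by (simp add: pos_def)
qed

text \<open>Numbers from \<open>9 * m\<close> on are people and places isolated in both graphs; they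
  never move and fill up the vertex sets to size \<open>n\<close>.\<close>

definition config :: "nat \<Rightarrow> nat \<Rightarrow> (nat \<Rightarrow> nat) \<Rightarrow> (nat \<Rightarrow> nat) \<Rightarrow> nat \<Rightarrow> nat" where
  "config m n t D = (\<lambda>p\<in>{..<n}. if p < 9 * m then enc (pos t D (dec p)) else p)"

lemma config_enc:
  assumes "fst u < m" "snd u < 9" "9 * m \<le> n"
  shows "config m n t D (enc u) = enc (pos t D u)"
  using assms enc_less[OF assms(1,2)] by (simp add: config_def)

lemma config_exch:
  assumes "pos t' D' = exch (pos t D) u v" "9 * m \<le> n"
    and "fst u < m" "snd u < 9" "fst v < m" "snd v < 9"
  shows "config m n t' D' = exch (config m n t D) (enc u) (enc v)"
proof
  fix p
  have "dec p = u \<longleftrightarrow> p = enc u" "dec p = v \<longleftrightarrow> p = enc v"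
    using assms by auto
  then show "config m n t' D' p = exch (config m n t D) (enc u) (enc v) p"
    using assms enc_less[of u m] enc_less[of v m] config_enc[of u m n t D] config_enc[of v m n t D]
    by (auto simp: exch_def config_def)
qed

abbreviation layered_fs :: "nat \<Rightarrow> nat \<Rightarrow> (nat \<Rightarrow> nat) pair_pre_digraph" where
  "layered_fs m n \<equiv> friends_strangers (layered n (friend m)) (layered n (link m))"

lemma config_arcD:
  assumes v: "valid m t D" and mn: "9 * m \<le> n" and arc: "(config m n t D, \<tau>) \<in> parcs (layered_fs m n)"
  shows "\<exists>t' D'. valid m t' D' \<and> \<tau> = config m n t' D' \<and> \<bar>progress k t' - progress k t\<bar> \<le> 1"
proof -
  note X = pair_graph_layered[OF friend_range mn] and Y = pair_graph_layered[OF link_range mn]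
  have "config m n t D \<in> pverts (layered_fs m n)"
    using arc by (auto simp: friends_strangers_def Let_def)
  then obtain a b where ab: "(a, b) \<in> parcs (layered n (friend m))"
    "(config m n t D a, config m n t D b) \<in> parcs (layered n (link m))" "\<tau> = exch (config m n t D) a b"
    using arc friends_strangers_arc_iff[OF X Y] by blast
  obtain u w where uw: "friend m u w" "(a, b) = (enc u, enc w) \<or> (a, b) = (enc w, enc u)"
    using ab(1) unfolding layered_arc_iff by blast
  have sym: "(p, q) \<in> parcs (layered n R) \<longleftrightarrow> (q, p) \<in> parcs (layered n R)" for p q R
    unfolding layered_arc_iff by blast
  have \<tau>: "\<tau> = exch (config m n t D) (enc u) (enc w)"
    and l: "(config m n t D (enc u), config m n t D (enc w)) \<in> parcs (layered n (link m))"
    using uw(2) ab(2,3) sym exch_commute by auto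
  note r = friend_range[OF uw(1)]
  have "(enc (pos t D u), enc (pos t D w)) \<in> parcs (layered n (link m))"
    using l r mn by (simp add: config_enc)
  then obtain x y where xy: "enc (pos t D u) = enc x" "enc (pos t D w) = enc y" "link m x y \<or> link m y x"
    unfolding layered_arc_iff by blast
  \<comment> \<open>\<open>enc\<close> can be cancelled only for second components below 9.\<close>
  have "snd x < 9" "snd y < 9" "snd (pos t D u) < 9" "snd (pos t D w) < 9"
    using xy(3) link_range pos_range[OF v] r by (metis, metis, (metis prod.collapse)+)
  then have "pos t D u = x" "pos t D w = y"
    using xy(1,2) dec_enc by metis+
  then obtain t' D' where "valid m t' D'" "pos t' D' = exch (pos t D) u w" "\<bar>progress k t' - progress k t\<bar> \<le> 1"
    using swap_closed[OF v uw(1)] xy(3) by blast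
  moreover from this have "config m n t' D' = \<tau>"
    using config_exch[of t' D' t D u w m n] r mn \<tau> by simp
  ultimately show ?thesis
    by (intro exI[of _ t'] exI[of _ D']) simp
qed

lemma config_arcI:
  assumes v: "valid m t D" and mn: "9 * m \<le> n" and V: "config m n t D \<in> pverts (layered_fs m n)"
    and "friend m u w" "link m (pos t D u) (pos t D w) \<or> link m (pos t D w) (pos t D u)"
    and "pos t' D' = exch (pos t D) u w"
  shows "(config m n t D, config m n t' D') \<in> parcs (layered_fs m n)"
proof -
  note X = pair_graph_layered[OF friend_range mn] and Y = pair_graph_layered[OF link_range mn]
  note r = friend_range[OF assms(4)]
  have "(enc u, enc w) \<in> parcs (layered n (friend m))"
    using assms(4) unfolding layered_arc_iff by blast
  moreover have "(config m n t D (enc u), config m n t D (enc w)) \<in> parcs (layered n (link m))"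
    using r mn assms(5) by (simp add: config_enc layered_arc_iff del: split_paired_Ex) blast
  ultimately show ?thesis
    using friends_strangers_arc_iff[OF X Y V] config_exch[OF assms(6) mn] r by blast
qed

section \<open>Connectedness\<close>

abbreviation rest :: "nat \<Rightarrow> nat" where
  "rest \<equiv> \<lambda>_. 0"

lemma valid_rest: "\<forall>j. t j \<le> 8 \<Longrightarrow> valid m t rest"
  by (simp add: valid_def)

lemma pos_rest: "pos t rest (i, b) = (i, slot (t i) b)"
  by (simp add: pos_def)

text \<open>With nobody displaced, \<open>slot\<close> maps each block of nine injectively into
  itself, and an injective self-map of a finite set is onto.\<close>

lemma config_rest_in_verts:
  assumes t: "\<forall>j. t j \<le> 8" and mn: "9 * m \<le> n"
  shows "config m n t rest \<in> pverts (layered_fs m n)"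
proof -
  let ?f = "config m n t rest"
  have val: "?f p = 9 * (p div 9) + slot (t (p div 9)) (p mod 9)" if "p < 9 * m" for p
    using that mn by (simp add: config_def dec_def enc_def pos_rest)
  have slot9: "slot (t i) (p mod 9) < 9" for i p
    using spec[OF t, of i] by (auto simp: slot_def intro: le_less_trans)
  have block: "?f p div 9 = p div 9" if "p < 9 * m" for p
    using val[OF that] slot9[of "p div 9" p] by simp
  have small: "?f p < 9 * m" if "p < 9 * m" for p
    using block[OF that] that
    by (metis div_less_iff_less_mult mult.commute zero_less_numeral)
  have "inj_on ?f {..<n}"
  proof (rule inj_onI)
    fix p q assume pq: "p \<in> {..<n}" "q \<in> {..<n}" "?f p = ?f q"
    consider "p < 9 * m" "q < 9 * m" | "\<not> p < 9 * m" "\<not> q < 9 * m" | "p < 9 * m" "\<not> q < 9 * m"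
      | "\<not> p < 9 * m" "q < 9 * m" by blast
    then show "p = q"
    proof cases
      case 1
      then have d: "p div 9 = q div 9"
        using block pq(3) by metis
      then have "slot (t (p div 9)) (p mod 9) = slot (t (p div 9)) (q mod 9)"
        using val 1 pq(3) by simp
      then have "p mod 9 = q mod 9"
        using slot_eq_iff by metis
      then show ?thesis
        using d by (metis div_mult_mod_eq)
    next
      case 2
      then show ?thesis using pq by (simp add: config_def)
    next
      case 3
      then show ?thesis using small[of p] pq by (simp add: config_def)
    next
      case 4
      then show ?thesis using small[of q] pq by (simp add: config_def)
    qed
  qed
  moreover have "?f ` {..<n} \<subseteq> {..<n}"
  proof
    fix y assume "y \<in> ?f ` {..<n}"
    then obtain p where p: "p < n" "y = ?f p" by auto
    show "y \<in> {..<n}"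
      using p small[of p] mn by (cases "p < 9 * m") (auto simp: config_def)
  qed
  ultimately have "bij_betw ?f {..<n} {..<n}"
    by (simp add: bij_betw_def endo_inj_surj)
  then show ?thesis
    by (simp add: friends_strangers_def Let_def config_def)
qed

text \<open>An ungated step is one swap. At a gate, \<open>A\<close>, \<open>B\<close>,
  \<open>C\<close> are the three swaps of a passage: lower token with upper token, upper token with
  blank, lower token with blank.\<close>

lemma reach_advance:
  assumes t: "\<forall>j. t j \<le> 8" and mn: "9 * m \<le> n" and i: "i < m" "t i < 8" "may_advance i t"
  shows "config m n t rest \<rightarrow>\<^sup>*\<^bsub>with_proj (layered_fs m n)\<^esub> config m n (t(i := Suc (t i))) rest"
proof -
  interpret pair_graph "layered_fs m n"
    by (intro pair_graph_friends_strangers pair_graph_layered[OF friend_range mn] pair_graph_layered[OF link_range mn])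
  let ?t = "t(i := Suc (t i))"
  have t': "\<forall>j. ?t j \<le> 8"
    using t i(2) by simp
  note V = config_rest_in_verts[OF t mn] and V' = config_rest_in_verts[OF t' mn]
  have fr: "friend m (i, 0) (i, Suc (t i))"
    using i by (simp add: friend_def)
  have n1: "slot (t i) 0 = t i" "slot (t i) (Suc (t i)) = Suc (t i)"
    by (simp_all add: slot_def)
  have n2: "slot (Suc (t i)) 0 = Suc (t i)" "slot (Suc (t i)) (Suc (t i)) = t i"
    by (simp_all add: slot_def)
  show ?thesis
  proof (cases "i = 0 \<or> \<not> gate (t i)")
    case True
    have "link m (pos t rest (i, 0)) (pos t rest (i, Suc (t i)))"
      using True i by (auto simp: pos_rest n1 link_simps)
    then have "(config m n t rest, config m n ?t rest) \<in> parcs (layered_fs m n)"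
      using config_arcI[OF valid_rest[OF t] mn V fr _ pos_advance] by blast
    then show ?thesis
      by (intro reachable_adjI) simp
  next
    case False
    then obtain k where k: "i = Suc k" by (cases i) auto
    define q where "q = t i"
    have g: "gate q" and tk: "t k = key_slot q"
      using False i(3) k by (auto simp: q_def may_advance_def)
    have q: "q \<in> {2..7}" "even q" "Suc q \<in> {2..7}" "key_slot (Suc q) = key_slot q" "Suc q \<in> {0, 3, 5, 7}" "q \<noteq> 0"
      using g by (auto simp: gate_def key_slot_def)
    let ?D = "rest(k := q)"
    have valD: "valid m t ?D"
      by (rule valid_displace[OF valid_rest[OF t]]) (use i(1) k q tk in \<open>auto simp: q_def\<close>)
    have occ: "occupant (t i) q = 0" "occupant (Suc (t i)) q = Suc q"
      by (auto simp: occupant_def q_def)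
    have "(config m n t rest, config m n t ?D) \<in> parcs (layered_fs m n)"
    proof (rule config_arcI[OF valid_rest[OF t] mn V])
      show "friend m (k, 0) (i, 0)"
        using i(1) k by (simp add: friend_def)
      show "link m (pos t rest (k, 0)) (pos t rest (i, 0)) \<or> link m (pos t rest (i, 0)) (pos t rest (k, 0))"
        using i(1) tk q(1) unfolding k by (simp add: pos_rest slot_def link_simps q_def k)
      show "pos t ?D = exch (pos t rest) (k, 0) (i, 0)"
        using pos_displace_valid[OF valid_rest[OF t] _ q(1) tk] occ(1) k by simp
    qed
    then have A: "config m n t rest \<rightarrow>\<^sup>*\<^bsub>with_proj (layered_fs m n)\<^esub> config m n t ?D"
      by (intro reachable_adjI) simp
    have "(config m n t ?D, config m n ?t ?D) \<in> parcs (layered_fs m n)"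
    proof (rule config_arcI[OF valD mn _ fr])
      \<comment> \<open>A displaced configuration is a bijection because it was reached by a
        swap.\<close>
      show "config m n t ?D \<in> pverts (layered_fs m n)"
        using A by (rule reachable_in_verts(2))
      have "pos t ?D (i, 0) = (k, t k)" "pos t ?D (i, Suc (t i)) = (i, Suc (t i))"
        using q(6) by (simp_all add: k pos_def slot_def q_def)
      then show "link m (pos t ?D (i, 0)) (pos t ?D (i, Suc (t i))) \<or>
          link m (pos t ?D (i, Suc (t i))) (pos t ?D (i, 0))"
        using q(3,4) tk i(1) by (simp add: k link_simps q_def)
      show "pos ?t ?D = exch (pos t ?D) (i, 0) (i, Suc (t i))"
        by (rule pos_advance) (simp add: k)
    qed
    then have B: "config m n t ?D \<rightarrow>\<^sup>*\<^bsub>with_proj (layered_fs m n)\<^esub> config m n ?t ?D"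
      by (intro reachable_adjI) simp
    \<comment> \<open>The third swap is established backwards, as a displacement, and then
      reversed.\<close>
    have "(config m n ?t rest, config m n ?t ?D) \<in> parcs (layered_fs m n)"
    proof (rule config_arcI[OF valid_rest[OF t'] mn V'])
      show "friend m (k, 0) (i, Suc q)"
        using i(1) k q(5) by (simp add: friend_def)
      show "link m (pos ?t rest (k, 0)) (pos ?t rest (i, Suc q)) \<or> link m (pos ?t rest (i, Suc q)) (pos ?t rest (k, 0))"
        using i(1) tk q(1) n2 by (simp add: pos_rest slot_def link_simps q_def k)
      have tk': "?t k = key_slot q"
        using tk k by simp
      have "?t (Suc k) = Suc (t i)"
        by (simp add: k)
      then show "pos ?t ?D = exch (pos ?t rest) (k, 0) (i, Suc q)"
        using pos_displace_valid[OF valid_rest[OF t'] refl q(1) tk'] by (simp only: occ(2)[unfolded k] k fun_upd_same)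
    qed
    then have C: "config m n ?t ?D \<rightarrow>\<^sup>*\<^bsub>with_proj (layered_fs m n)\<^esub> config m n ?t rest"
      by (intro reachable_adjI) (simp add: arcs_symmetric)
    show ?thesis
      by (rule reachable_trans[OF A reachable_trans[OF B C]])
  qed
qed

text \<open>The outer induction is over the layers, the inner one over the place of the token of
  layer \<open>k\<close>. Before each retreat of this token, the outer hypothesis rearranges the
  lower layers so that the gate is open.\<close>

lemma reach_zero:
  assumes mn: "9 * m \<le> n" and "k \<le> m" and t: "\<forall>j. t j \<le> 8"
  shows "config m n t rest \<rightarrow>\<^sup>*\<^bsub>with_proj (layered_fs m n)\<^esub> config m n (\<lambda>j. if j < k then 0 else t j) rest"
  using assms(2) t
proof (induction k arbitrary: t)
  case 0
  interpret pair_graph "layered_fs m n"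
    by (intro pair_graph_friends_strangers pair_graph_layered[OF friend_range mn] pair_graph_layered[OF link_range mn])
  show ?case
    using config_rest_in_verts[OF 0(2) mn] by simp
next
  case (Suc k)
  interpret pair_graph "layered_fs m n"
    by (intro pair_graph_friends_strangers pair_graph_layered[OF friend_range mn] pair_graph_layered[OF link_range mn])
  \<comment> \<open>Both reach the same arrangement with zeros below layer \<open>k\<close>, and
    reachability is symmetric.\<close>
  have mutual: "config m n s rest \<rightarrow>\<^sup>*\<^bsub>with_proj (layered_fs m n)\<^esub> config m n s' rest"
    if "\<forall>j. s j \<le> 8" "\<forall>j. s' j \<le> 8" "\<And>j. k \<le> j \<Longrightarrow> s j = s' j" for s s'
  proof -
    have "(\<lambda>j. if j < k then 0 else s j) = (\<lambda>j. if j < k then 0 else s' j)"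
      using that(3) by auto
    then have a: "config m n s rest \<rightarrow>\<^sup>*\<^bsub>with_proj (layered_fs m n)\<^esub> config m n (\<lambda>j. if j < k then 0 else s' j) rest"
      using Suc.IH[of s] Suc.prems(1) that(1) by simp
    have "config m n s' rest \<rightarrow>\<^sup>*\<^bsub>with_proj (layered_fs m n)\<^esub> config m n (\<lambda>j. if j < k then 0 else s' j) rest"
      using Suc.IH[of s'] Suc.prems(1) that(2) by simp
    from symmetric_reachable[OF sym_arcs this] show ?thesis
      by (rule reachable_trans[OF a])
  qed
  have "config m n t rest \<rightarrow>\<^sup>*\<^bsub>with_proj (layered_fs m n)\<^esub> config m n (\<lambda>j. if j < Suc k then 0 else t j) rest"
    if "t k = a" "\<forall>j. t j \<le> 8" for t a
    using that
  proof (induction a arbitrary: t)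
    case 0
    then show ?case
      by (intro mutual) (auto simp: less_Suc_eq)
  next
    case (Suc a)
    \<comment> \<open>The value \<open>key_slot a\<close> opens the gate at \<open>a\<close>, if
      there is one; using it in all lower layers avoids singling out layer
      \<open>k - 1\<close>.\<close>
    define u where "u = (\<lambda>j. if j < k then key_slot a else if j = k then a else t j)"
    have "key_slot a \<le> 8" by (simp add: key_slot_def)
    moreover have ta: "a < 8" using Suc.prems(1) spec[OF Suc.prems(2), of k] by simp
    ultimately have u: "\<forall>j. u j \<le> 8"
      using Suc.prems(2) by (auto simp: u_def)
    have "may_advance k u"
      by (auto simp: may_advance_def u_def)
    then have "config m n u rest \<rightarrow>\<^sup>*\<^bsub>with_proj (layered_fs m n)\<^esub> config m n (u(k := Suc (u k))) rest"
      using ta \<open>Suc k \<le> m\<close>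
      by (intro reach_advance[OF u mn]) (auto simp: u_def)
    then have 1: "config m n (u(k := Suc (u k))) rest \<rightarrow>\<^sup>*\<^bsub>with_proj (layered_fs m n)\<^esub> config m n u rest"
      by (rule symmetric_reachable[OF sym_arcs])
    have 2: "config m n t rest \<rightarrow>\<^sup>*\<^bsub>with_proj (layered_fs m n)\<^esub> config m n (u(k := Suc (u k))) rest"
    proof (rule mutual)
      show "\<forall>j. (u(k := Suc (u k))) j \<le> 8"
        using u ta by (auto simp: u_def)
    qed (use Suc.prems in \<open>auto simp: u_def\<close>)
    have "(\<lambda>j. if j < Suc k then 0 else u j) = (\<lambda>j. if j < Suc k then 0 else t j)"
      by (auto simp: u_def)
    then have 3: "config m n u rest \<rightarrow>\<^sup>*\<^bsub>with_proj (layered_fs m n)\<^esub> config m n (\<lambda>j. if j < Suc k then 0 else t j) rest"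
      using Suc.IH[of u] u by (simp add: u_def)
    show ?case
      by (rule reachable_trans[OF 2 reachable_trans[OF 1 3]])
  qed
  then show ?case
    using Suc.prems(2) by blast
qed

section \<open>Components of large diameter\<close>

lemma layered_component:
  assumes mn: "9 * Suc k \<le> n"
  shows "\<exists>C d. C \<in> components (with_proj (layered_fs (Suc k) n)) \<and> graph_diameter C = ereal d \<and> 2 ^ k \<le> d"
proof -
  let ?m = "Suc k"
  interpret pair_graph "layered_fs ?m n"
    by (intro pair_graph_friends_strangers pair_graph_layered[OF friend_range mn] pair_graph_layered[OF link_range mn])
  define top :: "nat \<Rightarrow> nat" where "top = (\<lambda>j. if j = k then 8 else 0)"
  define R where "R \<sigma> c \<longleftrightarrow> (\<exists>t D. valid ?m t D \<and> \<sigma> = config ?m n t D \<and> c = progress k t)" for \<sigma> c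
  have top: "\<forall>j. top j \<le> 8"
    by (simp add: top_def)
  have zero: "(\<lambda>j. if j < ?m then 0 else top j) = rest"
    by (auto simp: top_def)
  have "\<exists>C d. C \<in> components (with_proj (layered_fs ?m n)) \<and> graph_diameter C = ereal d \<and> real_of_int (2 ^ k) \<le> d"
  proof (rule ex_component_diameter_ge)
    show "pair_graph (layered_fs ?m n)" ..
    have "config ?m n top rest \<rightarrow>\<^sup>*\<^bsub>with_proj (layered_fs ?m n)\<^esub> config ?m n rest rest"
      using reach_zero[OF mn order_refl top] unfolding zero .
    then show "config ?m n rest rest \<rightarrow>\<^sup>*\<^bsub>with_proj (layered_fs ?m n)\<^esub> config ?m n top rest"
      by (rule symmetric_reachable[OF sym_arcs])
    show "R (config ?m n rest rest) 0"
      unfolding R_def using progress_low[of rest k] valid_rest[of rest ?m] by force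
    show "\<exists>c'. R y c' \<and> \<bar>c' - c\<bar> \<le> 1" if "(x, y) \<in> parcs (layered_fs ?m n)" "R x c" for x y c
      using that config_arcD[OF _ mn] unfolding R_def by blast
    \<comment> \<open>The top token has no layer above to be displaced into, so its place determines
      \<open>t k\<close>.\<close>
    show "2 ^ k \<le> c" if Rc: "R (config ?m n top rest) c" for c
    proof -
      obtain t D where v: "valid ?m t D" and eq: "config ?m n top rest = config ?m n t D" and c: "c = progress k t"
        using Rc unfolding R_def by blast
      have "enc (k, 8) = enc (pos t D (k, 0))"
        using fun_cong[OF eq, of "enc (k, 0)"] mn by (simp add: config_enc pos_rest slot_def top_def)
      then have "dec (enc (k, 8)) = dec (enc (pos t D (k, 0)))"
        by simp
      then have P: "pos t D (k, 0) = (k, 8)"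
        using pos_range[OF v, of 0 k] by simp
      have "D k = 0"
        using validD(1)[OF v, of k] by blast
      from P[unfolded pos_token[of D k t, OF this]] have "t k = 8"
        by (cases k) (simp_all split: if_splits)
      then show ?thesis
        using progress_high[of t k] c by simp
    qed
  qed
  then show ?thesis by simp
qed

text \<open>For \<open>n < 9\<close> no layer fits; a single edge still gives a positive diameter,
  so that its logarithm makes sense.\<close>

lemma small_component:
  assumes "2 \<le> n"
  shows "\<exists>(X :: nat pair_pre_digraph) C d. pair_graph X \<and> card (pverts X) = n \<and>
    C \<in> components (with_proj (friends_strangers X X)) \<and> graph_diameter C = ereal d \<and> 1 \<le> d"
proof -
  define X :: "nat pair_pre_digraph" where "X = \<lparr>pverts = {..<n}, parcs = {(0, 1), (1, 0)}\<rparr>"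
  have X: "pair_graph X"
    using assms by unfold_locales (auto simp: X_def symmetric_def intro!: symI)
  let ?u = "restrict id {..<n} :: nat \<Rightarrow> nat"
  have u: "?u \<in> pverts (friends_strangers X X)"
    by (auto simp: friends_strangers_def X_def bij_betw_def inj_on_def)
  have arc: "(?u, exch ?u 0 1) \<in> parcs (friends_strangers X X)"
    using assms unfolding friends_strangers_arc_iff[OF X X u] by (intro exI[of _ 0] exI[of _ 1]) (simp add: X_def)
  interpret pair_graph "friends_strangers X X"
    by (rule pair_graph_friends_strangers[OF X X])
  have "exch ?u 0 1 \<noteq> ?u"
    using assms by (auto simp: exch_def fun_eq_iff intro!: exI[of _ 0])
  then have "\<exists>C d. C \<in> components (with_proj (friends_strangers X X)) \<and> graph_diameter C = ereal d \<and> real_of_int 1 \<le> d"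
    by (intro ex_component_diameter_ge[where u = ?u and v = "exch ?u 0 1" and R = "\<lambda>\<sigma> c. c = (if \<sigma> = ?u then 0 else 1)"])
      (use arc in \<open>auto intro: pair_graph_friends_strangers[OF X X]\<close>)
  moreover have "card (pverts X) = n"
    by (simp add: X_def)
  ultimately show ?thesis
    using X by auto
qed

theorem theorem1p3:
  shows "\<exists>f :: nat \<Rightarrow> real. f \<in> \<Omega>(\<lambda>n. real n) \<and>
    (\<forall>n\<ge>2. \<exists>(X :: nat pair_pre_digraph) (Y :: nat pair_pre_digraph) C.
       pair_graph X \<and> card (pverts X) = n \<and>
       pair_graph Y \<and> card (pverts Y) = n \<and>
       C \<in> components (with_proj (friends_strangers X Y)) \<and>
       graph_diameter C = ereal (exp (f n)))"
proof -
  let ?P = "\<lambda>n d. \<exists>(X :: nat pair_pre_digraph) (Y :: nat pair_pre_digraph) C.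
       pair_graph X \<and> card (pverts X) = n \<and> pair_graph Y \<and> card (pverts Y) = n \<and>
       C \<in> components (with_proj (friends_strangers X Y)) \<and> graph_diameter C = ereal d"
  \<comment> \<open>\<open>n div 9\<close> layers give only exponent \<open>n div 9 - 1\<close>,
    hence the factor 2. Positivity allows \<open>d\<close> to be written as
    \<open>exp (ln d)\<close>.\<close>
  have "\<exists>d. ?P n d \<and> 0 < d \<and> 2 ^ (n div 9) \<le> 2 * d" if n: "2 \<le> n" for n
  proof (cases "n div 9")
    case 0
    obtain X :: "nat pair_pre_digraph" and C d where X: "pair_graph X" "card (pverts X) = n"
      "C \<in> components (with_proj (friends_strangers X X))" "graph_diameter C = ereal d" "1 \<le> d"
      using small_component[OF n] by blast
    then have "?P n d" by blast
    moreover have "0 < d" "2 ^ (n div 9) \<le> 2 * d"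
      using 0 X(5) by simp_all
    ultimately show ?thesis by blast
  next
    case (Suc k)
    then have mn: "9 * Suc k \<le> n"
      using div_times_less_eq_dividend[of n 9] by simp
    obtain C d where C: "C \<in> components (with_proj (layered_fs (Suc k) n))" "graph_diameter C = ereal d" "2 ^ k \<le> d"
      using layered_component[OF mn] by blast
    moreover have "0 < d"
      using C(3) by (rule less_le_trans[rotated]) simp
    moreover have "card (pverts (layered n R)) = n" for R
      by simp
    moreover have "pair_graph (layered n (friend (Suc k)))" "pair_graph (layered n (link (Suc k)))"
      using pair_graph_layered[OF friend_range mn] pair_graph_layered[OF link_range mn] by blast+
    ultimately have "?P n d" by blast
    moreover have "2 ^ (n div 9) \<le> 2 * d"
      using C(3) Suc by simp
    ultimately show ?thesis
      using \<open>0 < d\<close> by blast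
  qed
  then obtain d where d: "\<And>n. 2 \<le> n \<Longrightarrow> ?P n (d n)" "\<And>n. 2 \<le> n \<Longrightarrow> 0 < d n"
    "\<And>n. 2 \<le> n \<Longrightarrow> 2 ^ (n div 9) \<le> 2 * d n"
    by metis
  have "(\<lambda>n. ln (d n)) \<in> \<Omega>(\<lambda>n. real n)"
  \<comment> \<open>The layers give a rate of \<open>ln 2 / 9\<close>; half of it absorbs the
    rounding in \<open>n div 9\<close> and the factor 2 once \<open>n\<close> is at least
    54.\<close>
  proof (rule landau_omega.bigI[where c = "ln 2 / 18"])
    show "\<forall>\<^sub>F n in at_top. ln 2 / 18 * norm (real n) \<le> norm (ln (d n))"
    proof (rule eventually_at_top_linorderI[of 54])
      fix n :: nat assume n: "54 \<le> n"
      then have "n + 18 \<le> 18 * (n div 9)"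
        by linarith
      then have "real (n + 18) \<le> real (18 * (n div 9))"
        by (simp only: of_nat_le_iff)
      then have "real n \<le> 18 * (real (n div 9) - 1)"
        by (simp add: algebra_simps)
      then have "ln 2 * real n \<le> ln 2 * (18 * (real (n div 9) - 1))"
        by (intro mult_left_mono) auto
      then have "ln 2 / 18 * real n \<le> real (n div 9) * ln 2 - ln 2"
        by (simp add: field_simps)
      also have "\<dots> = ln (2 ^ (n div 9) / 2)"
        by (simp add: ln_div ln_realpow)
      also have "\<dots> \<le> ln (d n)"
        using d(2,3)[of n] n by (intro ln_mono) auto
      finally show "ln 2 / 18 * norm (real n) \<le> norm (ln (d n))"
        by simp
    qed
  qed simp
  moreover have "?P n (exp (ln (d n)))" if "2 \<le> n" for n
    using d(1,2)[OF that] by simp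
  ultimately show ?thesis
    by blast
qed

end
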